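(* Let $X$ be a connected multigraph and let $Y$ be a generalized truncation of $X$. Every component of $Y$ is eulerian if and only if $X$ is eulerian and, for every $v\in V(X)$, every vertex of the constituent $\mathrm{con}(v)$ has odd valency in $\mathrm{con}(v)$.
   Context: A multigraph may have multiple edges but no loops; it is assumed to have no isolated vertices. Generalized truncation of $X$: take a matching $M_0$ with $|M_0|=|E(X)|$ (on $2|E(X)|$ new vertices) and a bijection $F:E(X)\to M_0$; for each edge $e$ of $X$ with ends $u,v$, label one end of $F(e)$ by $u$ and the other by $v$. For $v\in V(X)$, the cluster $\mathrm{cl}(v)$ is the set of vertices labelled $v$; insert an arbitrary graph $\mathrm{con}(v)$ (the constituent at $v$) on $\mathrm{cl}(v)$. The result $F(M_0)\cup\bigcup_v\mathrm{con}(v)$ is a generalized truncation of $X$. A multigraph is eulerian if it has an Euler tour, i.e. a closed trail traversing every edge exactly once.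
   Formalization: The multigraph X (and each constituent) is assumed finite; for infinite X the claim fails, e.g. the two-way infinite path with doubled edges and constituents pairing parallel edges, where Y is a union of 4-cycles but X has no Euler tour. *)

theory Defs
  imports Main
begin

record ('v, 'e) mgraph =
  verts :: "'v set"
  edges :: "'e set"
  ends :: "'e \<Rightarrow> 'v set"

text \<open>Finite, loopless; isolated vertices are still allowed at this level because a
  constituent of a truncation may have them.\<close>

definition loopless_mgraph :: "('v, 'e) mgraph \<Rightarrow> bool" where
  "loopless_mgraph G \<longleftrightarrow>
     finite (verts G) \<and> finite (edges G) \<and>
     (\<forall>e\<in>edges G. ends G e \<subseteq> verts G \<and> card (ends G e) = 2)"

definition multigraph :: "('v, 'e) mgraph \<Rightarrow> bool" where
  "multigraph G \<longleftrightarrow>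
     loopless_mgraph G \<and> (\<forall>v\<in>verts G. \<exists>e\<in>edges G. v \<in> ends G e)"

text \<open>In a (simple) graph an edge is the two-element set of its ends.\<close>

definition simple_graph :: "('v, 'v set) mgraph \<Rightarrow> bool" where
  "simple_graph G \<longleftrightarrow> loopless_mgraph G \<and> ends G = (\<lambda>e. e)"

definition valency :: "('v, 'e) mgraph \<Rightarrow> 'v \<Rightarrow> nat" where
  "valency G v = card {e \<in> edges G. v \<in> ends G e}"

fun walk :: "('v, 'e) mgraph \<Rightarrow> 'v \<Rightarrow> 'e list \<Rightarrow> 'v \<Rightarrow> bool" where
  "walk G u [] w \<longleftrightarrow> u \<in> verts G \<and> u = w"
| "walk G u (e # es) w \<longleftrightarrow>
     e \<in> edges G \<and> (\<exists>x. ends G e = {u, x} \<and> walk G x es w)"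

definition closed_trail :: "('v, 'e) mgraph \<Rightarrow> 'e list \<Rightarrow> bool" where
  "closed_trail G es \<longleftrightarrow> distinct es \<and> (\<exists>u. walk G u es u)"

definition eulerian :: "('v, 'e) mgraph \<Rightarrow> bool" where
  "eulerian G \<longleftrightarrow> (\<exists>es. closed_trail G es \<and> set es = edges G)"

definition connected_mgraph :: "('v, 'e) mgraph \<Rightarrow> bool" where
  "connected_mgraph G \<longleftrightarrow>
     verts G \<noteq> {} \<and> (\<forall>u\<in>verts G. \<forall>w\<in>verts G. \<exists>es. walk G u es w)"

definition subgraph :: "('v, 'e) mgraph \<Rightarrow> ('v, 'e) mgraph \<Rightarrow> bool" where
  "subgraph H G \<longleftrightarrow>
     verts H \<subseteq> verts G \<and> edges H \<subseteq> edges G \<and> ends H = ends G \<and>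
     (\<forall>e\<in>edges H. ends H e \<subseteq> verts H)"

definition component :: "('v, 'e) mgraph \<Rightarrow> ('v, 'e) mgraph \<Rightarrow> bool" where
  "component C G \<longleftrightarrow>
     subgraph C G \<and> connected_mgraph C \<and>
     (\<forall>H. subgraph H G \<and> connected_mgraph H \<and> subgraph C H \<longrightarrow> H = C)"

definition matching :: "'w set set \<Rightarrow> bool" where
  "matching M \<longleftrightarrow>
     (\<forall>m\<in>M. card m = 2) \<and> (\<forall>m\<in>M. \<forall>m'\<in>M. m \<noteq> m' \<longrightarrow> m \<inter> m' = {})"

definition cluster :: "'w set set \<Rightarrow> ('w \<Rightarrow> 'v) \<Rightarrow> 'v \<Rightarrow> 'w set" where
  "cluster M0 lab v = {w \<in> \<Union>M0. lab w = v}"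

text \<open>\<open>lab\<close> is the labelling of the ends of the matching edges, and \<open>con v\<close> is the
  constituent at \<open>v\<close>. The condition \<open>card M0 = card (edges X)\<close> is contained in the
  bijectivity of \<open>F\<close>, and the underlying vertex set is \<open>\<Union>M0\<close>.\<close>

definition generalized_truncation ::
  "('v, 'e) mgraph \<Rightarrow> 'w set set \<Rightarrow> ('e \<Rightarrow> 'w set) \<Rightarrow> ('w \<Rightarrow> 'v) \<Rightarrow>
     ('v \<Rightarrow> ('w, 'w set) mgraph) \<Rightarrow> ('w, 'w set) mgraph \<Rightarrow> bool" where
  "generalized_truncation X M0 F lab con Y \<longleftrightarrow>
     matching M0 \<and>
     bij_betw F (edges X) M0 \<and>
     (\<forall>e\<in>edges X. bij_betw lab (F e) (ends X e)) \<and>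
     (\<forall>v\<in>verts X. simple_graph (con v) \<and> verts (con v) = cluster M0 lab v) \<and>
     Y = \<lparr>verts = \<Union>M0,
          edges = M0 \<union> (\<Union>v\<in>verts X. edges (con v)),
          ends = (\<lambda>e. e)\<rparr>"

end

theory Submission
  imports Defs
begin

text \<open>By Euler's theorem a component of \<open>Y\<close> is eulerian iff all its valencies are even. Every
  vertex \<open>w\<close> of \<open>Y\<close> lies on exactly one matching edge, so its valency is one more than its valency
  in its constituent; hence all components of \<open>Y\<close> are eulerian iff all constituent valencies are odd.
  In that case the handshake lemma makes every constituent have an even number of vertices, and
  this number is the valency of \<open>v\<close> in \<open>X\<close>, so \<open>X\<close> is eulerian as well.\<close>

section \<open>Walks\<close>

lemma loopless_mgraphD:
  assumes "loopless_mgraph G"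
  shows "finite (verts G)" "finite (edges G)"
    "e \<in> edges G \<Longrightarrow> ends G e \<subseteq> verts G" "e \<in> edges G \<Longrightarrow> card (ends G e) = 2"
  using assms unfolding loopless_mgraph_def by blast+

lemma ends_other_end:
  assumes "loopless_mgraph G" "e \<in> edges G" "x \<in> ends G e"
  obtains y where "ends G e = {x, y}" "y \<noteq> x" "y \<in> verts G"
proof -
  obtain a b where "ends G e = {a, b}" "a \<noteq> b"
    using loopless_mgraphD(4)[OF assms(1,2)] by (meson card_2_iff)
  moreover have "ends G e \<subseteq> verts G" using loopless_mgraphD(3)[OF assms(1,2)] .
  ultimately show thesis using that assms(3) by (cases "x = a") auto
qed

lemma walk_append:
  "walk G u p x \<Longrightarrow> walk G x q w \<Longrightarrow> walk G u (p @ q) w"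
  by (induction p arbitrary: u) auto

lemma walk_end_in_verts: "walk G u p x \<Longrightarrow> x \<in> verts G"
  by (induction p arbitrary: u) auto

lemma walk_edges: "walk G u p x \<Longrightarrow> set p \<subseteq> edges G"
  by (induction p arbitrary: u) auto

text \<open>The cons case of \<open>walk\<close> does not demand that its start be a vertex; for a
  nonempty walk this comes from the ends of edges lying in \<open>verts G\<close>.\<close>

lemma walk_start_in_verts:
  "loopless_mgraph G \<Longrightarrow> walk G u p x \<Longrightarrow> u \<in> verts G"
  by (cases p) (use loopless_mgraphD(3) in fastforce)+

lemma walk_rev:
  assumes "loopless_mgraph G"
  shows "walk G u p x \<Longrightarrow> walk G x (rev p) u"
proof (induction p arbitrary: u)
  case Nil
  then show ?case by auto
next
  case (Cons e p)
  then obtain y where y: "e \<in> edges G" "ends G e = {u, y}" "walk G y p x" by auto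
  have "u \<in> verts G" using walk_start_in_verts[OF assms Cons.prems] .
  then have "walk G y [e] u" using y by (auto simp: insert_commute)
  then show ?case using walk_append[OF Cons.IH[OF y(3)]] by simp
qed

lemma walk_subgraph:
  "subgraph H G \<Longrightarrow> walk H u p x \<Longrightarrow> walk G u p x"
  by (induction p arbitrary: u) (auto simp: subgraph_def)

text \<open>Any two vertices are joined through \<open>x\<close>: reverse the walk from
  \<open>x\<close> to one of them and append the walk from \<open>x\<close> to the other.\<close>

lemma connected_mgraphI:
  assumes "loopless_mgraph G" "x \<in> verts G"
    and "\<And>y. y \<in> verts G \<Longrightarrow> \<exists>p. walk G x p y"
  shows "connected_mgraph G"
  unfolding connected_mgraph_def
  using assms walk_append walk_rev[OF assms(1)] by (metis emptyE)

lemma walk_leaves_set: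
  assumes "walk G u p a" "u \<in> S" "a \<notin> S"
  shows "\<exists>e\<in>edges G. \<exists>x y. ends G e = {x, y} \<and> x \<in> S \<and> y \<notin> S"
  using assms
proof (induction p arbitrary: u)
  case Nil
  then show ?case by auto
next
  case (Cons e p)
  then show ?case by (metis walk.simps(2))
qed

text \<open>A walk passes through both ends of each of its edges. Cutting it there is what allows a
  closed trail to be restarted at any vertex that it meets.\<close>

lemma walk_split_at_edge_end:
  assumes "loopless_mgraph G" "walk G u p w" "e \<in> set p" "x \<in> ends G e"
  shows "\<exists>p1 p2. p = p1 @ p2 \<and> walk G u p1 x \<and> walk G x p2 w"
  using assms(2-4)
proof (induction p arbitrary: u)
  case Nil
  then show ?case by auto
next
  case (Cons f p)
  then obtain y where y: "f \<in> edges G" "ends G f = {u, y}" "walk G y p w" by auto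
  have uv: "u \<in> verts G" using walk_start_in_verts[OF assms(1) Cons.prems(1)] .
  have yv: "y \<in> verts G" using walk_start_in_verts[OF assms(1) y(3)] .
  consider "x = u" | "x = y" | "e \<in> set p" using Cons.prems y by auto
  then show ?case
  proof cases
    case 1
    then have "walk G u [] x" "walk G x (f # p) w" using Cons.prems(1) uv by simp_all
    then show ?thesis by (metis append_Nil)
  next
    case 2
    then have "walk G u [f] x" "walk G x p w" using y yv by simp_all
    then show ?thesis by (metis append_Cons append_Nil)
  next
    case 3
    then obtain p1 p2 where "p = p1 @ p2" "walk G y p1 x" "walk G x p2 w"
      using Cons.IH[OF y(3)] Cons.prems(3) by blast
    then have "walk G u (f # p1) x" "f # p = (f # p1) @ p2" using y by auto
    then show ?thesis using \<open>walk G x p2 w\<close> by blast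
  qed
qed

section \<open>Euler's theorem\<close>

text \<open>Every passage of a trail through \<open>v\<close> uses two edges at \<open>v\<close>, so
  only the start and the end affect the parity, and they cancel when they coincide. In the induction
  a new first edge flips the parity at exactly its two ends, which differ since there are no
  loops.\<close>

lemma trail_valency_parity:
  assumes "loopless_mgraph G" "walk G u p w" "distinct p"
  shows "even (card {e \<in> set p. v \<in> ends G e}) \<longleftrightarrow> (v = u) = (v = w)"
  using assms(2,3)
proof (induction p arbitrary: u)
  case Nil
  then show ?case by auto
next
  case (Cons f p)
  then obtain y where y: "f \<in> edges G" "ends G f = {u, y}" "walk G y p w" by auto
  have "u \<noteq> y" using loopless_mgraphD(4)[OF assms(1) y(1)] y(2) by auto
  have IH: "even (card {e \<in> set p. v \<in> ends G e}) \<longleftrightarrow> (v = y) = (v = w)"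
    using Cons.IH[OF y(3)] Cons.prems by simp
  show ?case
  proof (cases "v \<in> ends G f")
    case True
    then have "{e \<in> set (f # p). v \<in> ends G e} = insert f {e \<in> set p. v \<in> ends G e}" by auto
    then have "card {e \<in> set (f # p). v \<in> ends G e} = Suc (card {e \<in> set p. v \<in> ends G e})"
      using Cons.prems(2) by simp
    then show ?thesis using IH True y(2) \<open>u \<noteq> y\<close> by auto
  next
    case False
    then have "{e \<in> set (f # p). v \<in> ends G e} = {e \<in> set p. v \<in> ends G e}" by auto
    then show ?thesis using IH False y(2) by auto
  qed
qed

lemma eulerian_imp_even_valency:
  assumes "loopless_mgraph G" "eulerian G"
  shows "even (valency G v)"
  using assms trail_valency_parity[OF assms(1)]
  unfolding eulerian_def closed_trail_def valency_def by metis

text \<open>A longest trail, open or closed, is shown to be closed by parity and then to exhaust all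
  edges by connectedness, since otherwise it could be lengthened.\<close>

lemma even_valency_imp_eulerian:
  assumes G: "loopless_mgraph G" and conn: "connected_mgraph G"
    and even: "\<And>v. v \<in> verts G \<Longrightarrow> even (valency G v)"
  shows "eulerian G"
proof -
  define trail where "trail p \<longleftrightarrow> distinct p \<and> (\<exists>u w. walk G u p w)" for p
  note fin = loopless_mgraphD(2)[OF G]
  obtain v where "v \<in> verts G" using conn unfolding connected_mgraph_def by auto
  then have "walk G v [] v" by simp
  then have "trail []" unfolding trail_def by (metis distinct.simps(1))
  \<comment> \<open>A trail repeats no edge, so lengths of trails are bounded and a longest trail
    exists.\<close>
  moreover have "\<forall>p. trail p \<longrightarrow> length p < Suc (card (edges G))"
    unfolding trail_def using walk_edges fin by (metis card_mono distinct_card less_Suc_eq_le)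
  ultimately obtain p where p: "trail p" and longest: "\<And>q. trail q \<Longrightarrow> length q \<le> length p"
    using ex_has_greatest_nat[of trail "[]" length] by blast
  from p obtain u w where d: "distinct p" and uw: "walk G u p w" unfolding trail_def by blast
  have u: "u \<in> verts G" using walk_start_in_verts[OF G uw] .
  have no_extension: False
    if q: "walk G x q y" "distinct q" "length q = length p" "set q = set p"
      and f: "f \<in> edges G" "f \<notin> set p" "x \<in> ends G f" for x y q f
  proof -
    obtain z where "ends G f = {x, z}" using ends_other_end[OF G f(1,3)] .
    then have "ends G f = {z, x}" by auto
    then have "trail (f # q)" unfolding trail_def using q f
      by (intro conjI exI[of _ z] exI[of _ y]) auto
    then show False using longest[of "f # q"] q(3) by simp
  qed
  have "u = w"
  proof (rule ccontr)
    assume "u \<noteq> w"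
    then have "odd (card {e \<in> set p. u \<in> ends G e})" using trail_valency_parity[OF G uw d] by auto
    then have "{e \<in> set p. u \<in> ends G e} \<noteq> {e \<in> edges G. u \<in> ends G e}"
      using even[OF u] unfolding valency_def by metis
    then obtain f where "f \<in> edges G" "f \<notin> set p" "u \<in> ends G f"
      using walk_edges[OF uw] by blast
    then show False using no_extension[OF uw d] by simp
  qed
  have "edges G \<subseteq> set p"
  proof (rule ccontr)
    assume "\<not> edges G \<subseteq> set p"
    then obtain f where f: "f \<in> edges G" "f \<notin> set p" by blast
    \<comment> \<open>These are the vertices met by the closed trail, recorded together with the cut
      needed to rotate it.\<close>
    define S where "S = {x. \<exists>p1 p2. p = p1 @ p2 \<and> walk G u p1 x \<and> walk G x p2 u}"
    have "u \<in> S" unfolding S_def using u uw \<open>u = w\<close> by (auto intro: exI[of _ "[]"])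
    have "\<exists>g x. g \<in> edges G \<and> g \<notin> set p \<and> x \<in> ends G g \<and> x \<in> S"
    proof -
      obtain a b where ab: "ends G f = {a, b}"
        using loopless_mgraphD(4)[OF G f(1)] by (meson card_2_iff)
      then have "a \<in> verts G" using loopless_mgraphD(3)[OF G f(1)] by auto
      then obtain q where q: "walk G u q a" using conn u unfolding connected_mgraph_def by blast
      show ?thesis
      proof (cases "a \<in> S")
        case True
        then show ?thesis using f ab by blast
      next
        case False
        then obtain g x y where g: "g \<in> edges G" "ends G g = {x, y}" "x \<in> S" "y \<notin> S"
          using walk_leaves_set[OF q \<open>u \<in> S\<close>] by blast
        have "g \<notin> set p"
        proof
          assume "g \<in> set p"
          then have "y \<in> S" unfolding S_def
            using walk_split_at_edge_end[OF G uw, of g y] g(2) \<open>u = w\<close> by auto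
          then show False using g(4) by simp
        qed
        then show ?thesis using g by blast
      qed
    qed
    then obtain g x where g: "g \<in> edges G" "g \<notin> set p" "x \<in> ends G g" "x \<in> S" by blast
    then obtain p1 p2 where p12: "p = p1 @ p2" "walk G u p1 x" "walk G x p2 u"
      unfolding S_def by blast
    have "walk G x (p2 @ p1) x" using walk_append p12 by fast
    then show False using no_extension[of x "p2 @ p1" x g] g p12(1) d by auto
  qed
  then have "set p = edges G" using walk_edges[OF uw] by auto
  then show ?thesis unfolding eulerian_def closed_trail_def using d uw \<open>u = w\<close> by blast
qed

text \<open>Handshake lemma: counting incidences by edges gives an even sum of valencies, and a sum
  of odd numbers is even only if it has an even number of terms.\<close>

lemma even_card_verts_if_odd_valency:
  assumes G: "loopless_mgraph G" and odd: "\<And>v. v \<in> verts G \<Longrightarrow> odd (valency G v)"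
  shows "even (card (verts G))"
proof -
  have "{v \<in> verts G. v \<in> ends G e} = ends G e" if "e \<in> edges G" for e
    using loopless_mgraphD(3)[OF G that] by auto
  then have "(\<Sum>v\<in>verts G. valency G v) = 2 * card (edges G)"
    unfolding valency_def using loopless_mgraphD[OF G] by (intro sum_multicount) auto
  then have "even (\<Sum>v\<in>verts G. valency G v)" by simp
  then have "even (card {v \<in> verts G. odd (valency G v)})"
    using even_sum_iff[OF loopless_mgraphD(1)[OF G]] by blast
  moreover have "{v \<in> verts G. odd (valency G v)} = verts G" using odd by auto
  ultimately show ?thesis by simp
qed

section \<open>Components\<close>

lemma subgraph_loopless:
  assumes "loopless_mgraph G" "subgraph H G"
  shows "loopless_mgraph H"
  using assms unfolding loopless_mgraph_def subgraph_def
  by (metis finite_subset subsetD)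

text \<open>The component is the subgraph induced on the set \<open>R\<close> of vertices reachable
  from \<open>w\<close>. A connected subgraph containing it contains \<open>w\<close>, hence has all
  its vertices in \<open>R\<close>, and so all its edges in the induced subgraph.\<close>

lemma ex_component:
  assumes G: "loopless_mgraph G" and w: "w \<in> verts G"
  shows "\<exists>C. component C G \<and> w \<in> verts C"
proof -
  define R where "R = {x. \<exists>p. walk G w p x}"
  define C where "C = \<lparr>verts = R, edges = {e \<in> edges G. ends G e \<subseteq> R}, ends = ends G\<rparr>"
  have wR: "w \<in> R" unfolding R_def using w by (auto intro: exI[of _ "[]"])
  have sub: "subgraph C G"
    unfolding subgraph_def C_def R_def using walk_end_in_verts by fastforce
  have closed: "y \<in> R" if "x \<in> R" "e \<in> edges G" "ends G e = {x, y}" for x y e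
  proof -
    have "y \<in> verts G" using that loopless_mgraphD(3)[OF G] by blast
    then have "walk G x [e] y" using that by auto
    moreover obtain p where "walk G w p x" using \<open>x \<in> R\<close> unfolding R_def by blast
    ultimately have "walk G w (p @ [e]) y" by (rule walk_append[rotated])
    then show ?thesis unfolding R_def by blast
  qed
  \<comment> \<open>Walks that start in \<open>R\<close> never leave \<open>R\<close>, so
    reachability in \<open>G\<close> becomes reachability inside \<open>C\<close>.\<close>
  have walkC: "walk C u p x" if "walk G u p x" "u \<in> R" for u p x
    using that
  proof (induction p arbitrary: u)
    case Nil
    then show ?case by (auto simp: C_def)
  next
    case (Cons e p)
    then obtain y where y: "e \<in> edges G" "ends G e = {u, y}" "walk G y p x" by auto
    have "y \<in> R" using closed Cons.prems(2) y by blast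
    then show ?case using Cons y by (auto simp: C_def)
  qed
  have "connected_mgraph C"
  proof (rule connected_mgraphI[OF subgraph_loopless[OF G sub]])
    show "w \<in> verts C" using wR by (simp add: C_def)
    show "\<exists>p. walk C w p y" if "y \<in> verts C" for y
    proof -
      have "\<exists>p. walk G w p y" using that by (simp add: C_def R_def)
      then show ?thesis using walkC[OF _ wR] by blast
    qed
  qed
  moreover have "H = C" if H: "subgraph H G" "connected_mgraph H" "subgraph C H" for H
  proof -
    have "w \<in> verts H" using H(3) wR by (auto simp: subgraph_def C_def)
    then have "verts H \<subseteq> R"
      using H(2) walk_subgraph[OF H(1)] unfolding connected_mgraph_def R_def by blast
    then have "verts H = verts C" "edges H = edges C" "ends H = ends C"
      using H(1,3) by (fastforce simp: subgraph_def C_def)+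
    then show ?thesis by simp
  qed
  ultimately show ?thesis using sub wR unfolding component_def by (auto simp: C_def)
qed

text \<open>Adding \<open>e\<close> and its other end to \<open>C\<close> keeps it connected, so by
  maximality nothing was added.\<close>

lemma component_contains_incident_edge:
  assumes G: "loopless_mgraph G" and C: "component C G"
    and x: "x \<in> verts C" and e: "e \<in> edges G" "x \<in> ends G e"
  shows "e \<in> edges C"
proof -
  have sub: "subgraph C G" and conn: "connected_mgraph C"
    using C unfolding component_def by blast+
  obtain y where y: "ends G e = {x, y}" "y \<in> verts G" using ends_other_end[OF G e] .
  define H where "H = \<lparr>verts = insert y (verts C), edges = insert e (edges C), ends = ends G\<rparr>"
  have HG: "subgraph H G" and CH: "subgraph C H"
    using sub e y x unfolding subgraph_def H_def by fastforce+
  have "connected_mgraph H"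
  proof (rule connected_mgraphI[OF subgraph_loopless[OF G HG]])
    show "x \<in> verts H" using x by (simp add: H_def)
    show "\<exists>p. walk H x p z" if "z \<in> verts H" for z
    proof (cases "z = y")
      case True
      then have "walk H x [e] z" using y by (auto simp: H_def)
      then show ?thesis by blast
    next
      case False
      then have "z \<in> verts C" using that by (simp add: H_def)
      then show ?thesis using conn x walk_subgraph[OF CH] unfolding connected_mgraph_def by blast
    qed
  qed
  then have "H = C" using C HG CH unfolding component_def by blast
  moreover have "e \<in> edges H" by (simp add: H_def)
  ultimately show ?thesis by simp
qed

lemma component_valency:
  assumes "loopless_mgraph G" "component C G" "x \<in> verts C"
  shows "valency C x = valency G x"
proof -
  have "{e \<in> edges C. x \<in> ends C e} = {e \<in> edges G. x \<in> ends G e}"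
    using component_contains_incident_edge[OF assms] assms(2)
    unfolding component_def subgraph_def by auto
  then show ?thesis by (simp add: valency_def)
qed

text \<open>Every vertex lies in some component and has the same valency there as in
  \<open>G\<close>, so Euler's theorem can be applied to one component at a time.\<close>

lemma components_eulerian_iff:
  assumes G: "loopless_mgraph G"
  shows "(\<forall>C. component C G \<longrightarrow> eulerian C) \<longleftrightarrow> (\<forall>w\<in>verts G. even (valency G w))"
proof
  assume *: "\<forall>C. component C G \<longrightarrow> eulerian C"
  show "\<forall>w\<in>verts G. even (valency G w)"
  proof
    fix w assume "w \<in> verts G"
    then obtain C where C: "component C G" "w \<in> verts C" using ex_component[OF G] by blast
    then have "loopless_mgraph C" using subgraph_loopless[OF G] unfolding component_def by blast
    then have "even (valency C w)" using eulerian_imp_even_valency * C(1) by metis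
    then show "even (valency G w)" using component_valency[OF G C] by simp
  qed
next
  assume *: "\<forall>w\<in>verts G. even (valency G w)"
  show "\<forall>C. component C G \<longrightarrow> eulerian C"
  proof (intro allI impI)
    fix C assume C: "component C G"
    then have sub: "subgraph C G" and conn: "connected_mgraph C"
      unfolding component_def by blast+
    show "eulerian C"
    proof (rule even_valency_imp_eulerian[OF subgraph_loopless[OF G sub] conn])
      fix v assume "v \<in> verts C"
      then show "even (valency C v)"
        using component_valency[OF G C] * sub unfolding subgraph_def by auto
    qed
  qed
qed

section \<open>Generalized truncations\<close>

lemma generalized_truncation_label:
  assumes X: "loopless_mgraph X" and T: "generalized_truncation X M0 F lab con Y"
    and w: "w \<in> \<Union>M0"
  shows "lab w \<in> verts X" "w \<in> verts (con (lab w))"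
proof -
  have "M0 = F ` edges X"
    using T unfolding generalized_truncation_def bij_betw_def by blast
  then obtain e where e: "e \<in> edges X" "w \<in> F e" using w by auto
  moreover have "lab ` F e = ends X e"
    using T e(1) unfolding generalized_truncation_def bij_betw_def by blast
  ultimately show "lab w \<in> verts X" using loopless_mgraphD(3)[OF X] by blast
  then show "w \<in> verts (con (lab w))"
    using T w unfolding generalized_truncation_def cluster_def by auto
qed

lemma generalized_truncation_con_edge:
  assumes "generalized_truncation X M0 F lab con Y" "v \<in> verts X" "m \<in> edges (con v)"
  shows "m \<subseteq> cluster M0 lab v" "card m = 2"
  using assms unfolding generalized_truncation_def simple_graph_def loopless_mgraph_def by metis+

lemma generalized_truncation_loopless:
  assumes X: "loopless_mgraph X" and T: "generalized_truncation X M0 F lab con Y"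
  shows "loopless_mgraph Y"
proof -
  have M0: "matching M0" "M0 = F ` edges X"
    and Y: "Y = \<lparr>verts = \<Union>M0, edges = M0 \<union> (\<Union>v\<in>verts X. edges (con v)), ends = (\<lambda>e. e)\<rparr>"
    and con: "\<forall>v\<in>verts X. loopless_mgraph (con v)"
    using T unfolding generalized_truncation_def bij_betw_def simple_graph_def by blast+
  have two: "\<forall>m\<in>M0. card m = 2" using M0(1) unfolding matching_def by blast
  have "finite M0" using M0(2) loopless_mgraphD(2)[OF X] by simp
  \<comment> \<open>Each matching edge is finite because \<open>card\<close> is 0 on infinite sets,
    whereas here it is 2.\<close>
  moreover have "finite (\<Union>M0)"
    using \<open>finite M0\<close> two by (metis card.infinite finite_Union zero_neq_numeral)
  moreover have "finite (\<Union>v\<in>verts X. edges (con v))"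
    using con loopless_mgraphD(1)[OF X] loopless_mgraphD(2) by blast
  moreover have "m \<subseteq> \<Union>M0 \<and> card m = 2" if "v \<in> verts X" "m \<in> edges (con v)" for v m
    using generalized_truncation_con_edge[OF T that] unfolding cluster_def by auto
  ultimately show ?thesis unfolding loopless_mgraph_def Y using two by auto
qed

text \<open>The additional 1 is the unique matching edge at \<open>w\<close>; all other edges of
  \<open>Y\<close> at \<open>w\<close> belong to the constituent at \<open>lab w\<close>.\<close>

lemma generalized_truncation_valency:
  assumes X: "loopless_mgraph X" and T: "generalized_truncation X M0 F lab con Y"
    and w: "w \<in> \<Union>M0"
  shows "valency Y w = Suc (valency (con (lab w)) w)"
proof -
  have M0: "matching M0" "bij_betw F (edges X) M0"
    and lab: "\<forall>e\<in>edges X. bij_betw lab (F e) (ends X e)"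
    and con: "\<forall>v\<in>verts X. simple_graph (con v)"
    and Y: "Y = \<lparr>verts = \<Union>M0, edges = M0 \<union> (\<Union>v\<in>verts X. edges (con v)), ends = (\<lambda>e. e)\<rparr>"
    using T unfolding generalized_truncation_def by blast+
  note lw = generalized_truncation_label(1)[OF X T w]
  have con_lab: "lab x = v" if "v \<in> verts X" "m \<in> edges (con v)" "x \<in> m" for v m x
    using generalized_truncation_con_edge(1)[OF T that(1,2)] that(3) unfolding cluster_def by auto
  obtain m where m: "m \<in> M0" "w \<in> m" using w by blast
  have m_unique: "m' = m" if "m' \<in> M0" "w \<in> m'" for m'
    using M0(1) m that unfolding matching_def by blast
  \<comment> \<open>Edges of \<open>Y\<close> are sets of ends, so a matching edge that was also a
    constituent edge would be counted only once. This cannot happen: the ends of \<open>m\<close>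
    carry two different labels, those of a constituent edge a single one.\<close>
  have m_notin: "m \<notin> edges (con (lab w))"
  proof
    assume "m \<in> edges (con (lab w))"
    then have "lab ` m \<subseteq> {lab w}" using con_lab[OF lw] by auto
    moreover obtain e where "e \<in> edges X" "m = F e" using M0(2) m unfolding bij_betw_def by auto
    then have "card (lab ` m) = 2"
      using lab loopless_mgraphD(4)[OF X] by (metis bij_betw_imp_surj_on)
    ultimately show False using card_mono[of "{lab w}" "lab ` m"] by simp
  qed
  have ends: "ends (con (lab w)) = (\<lambda>e. e)" and fin: "finite (edges (con (lab w)))"
    using con lw unfolding simple_graph_def loopless_mgraph_def by auto
  \<comment> \<open>Edges of other constituents avoid \<open>w\<close>, since all their ends carry a
    label other than \<open>lab w\<close>.\<close>
  have "{m' \<in> edges Y. w \<in> ends Y m'} = insert m {m' \<in> edges (con (lab w)). w \<in> m'}"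
  proof (intro set_eqI iffI)
    fix m' assume "m' \<in> {m' \<in> edges Y. w \<in> ends Y m'}"
    then consider "m' \<in> M0" "w \<in> m'" | v where "v \<in> verts X" "m' \<in> edges (con v)" "w \<in> m'"
      unfolding Y by auto
    then show "m' \<in> insert m {m' \<in> edges (con (lab w)). w \<in> m'}"
      by cases (use m_unique con_lab in blast)+
  next
    fix m' assume "m' \<in> insert m {m' \<in> edges (con (lab w)). w \<in> m'}"
    then show "m' \<in> {m' \<in> edges Y. w \<in> ends Y m'}"
      unfolding Y using m lw by auto
  qed
  then show ?thesis unfolding valency_def ends using m_notin fin by simp
qed

text \<open>Since \<open>lab\<close> maps \<open>F e\<close> bijectively onto the ends of
  \<open>e\<close>, each edge at \<open>v\<close> contributes exactly one vertex labelled
  \<open>v\<close>. Distinct edges contribute distinct vertices because \<open>M0\<close> is a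
  matching.\<close>

lemma card_cluster:
  assumes X: "loopless_mgraph X" and T: "generalized_truncation X M0 F lab con Y"
  shows "card (cluster M0 lab v) = valency X v"
proof -
  have M0: "matching M0" "bij_betw F (edges X) M0"
    and lab: "\<And>e. e \<in> edges X \<Longrightarrow> bij_betw lab (F e) (ends X e)"
    using T unfolding generalized_truncation_def by blast+
  define E where "E = {e \<in> edges X. v \<in> ends X e}"
  define A where "A e = {w \<in> F e. lab w = v}" for e
  have single: "\<exists>w. A e = {w}" if "e \<in> E" for e
  proof -
    have e: "inj_on lab (F e)" "v \<in> lab ` F e"
      using lab[of e] that unfolding E_def bij_betw_def by auto
    then obtain w where "w \<in> F e" "lab w = v" by blast
    then have "A e = {w}" using e(1) unfolding A_def inj_on_def by blast
    then show ?thesis by blast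
  qed
  have "cluster M0 lab v = (\<Union>e\<in>E. A e)"
  proof
    show "cluster M0 lab v \<subseteq> (\<Union>e\<in>E. A e)"
    proof
      fix w assume "w \<in> cluster M0 lab v"
      then obtain e where "e \<in> edges X" "w \<in> F e" "lab w = v"
        using M0(2) unfolding cluster_def bij_betw_def by auto
      then show "w \<in> (\<Union>e\<in>E. A e)"
        using lab[of e] unfolding E_def A_def bij_betw_def by auto
    qed
    show "(\<Union>e\<in>E. A e) \<subseteq> cluster M0 lab v"
      using M0(2) unfolding cluster_def bij_betw_def E_def A_def by auto
  qed
  moreover have "card (\<Union>e\<in>E. A e) = (\<Sum>e\<in>E. card (A e))"
  proof (rule card_UN_disjoint)
    show "finite E" using loopless_mgraphD(2)[OF X] by (simp add: E_def)
    show "\<forall>e\<in>E. finite (A e)" using single by fastforce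
    show "\<forall>e\<in>E. \<forall>f\<in>E. e \<noteq> f \<longrightarrow> A e \<inter> A f = {}"
    proof (intro ballI impI)
      fix e f assume "e \<in> E" "f \<in> E" "e \<noteq> f"
      then have "F e \<in> M0" "F f \<in> M0" "F e \<noteq> F f"
        using M0(2) unfolding E_def bij_betw_def inj_on_def by auto
      then have "F e \<inter> F f = {}" using M0(1) unfolding matching_def by blast
      then show "A e \<inter> A f = {}" unfolding A_def by blast
    qed
  qed
  moreover have "(\<Sum>e\<in>E. card (A e)) = (\<Sum>e\<in>E. 1)"
    using single by (intro sum.cong) fastforce+
  ultimately show ?thesis by (simp add: valency_def E_def)
qed

theorem theorem4p2:
  fixes X :: "('v, 'e) mgraph"
    and M0 :: "'w set set"
    and F :: "'e \<Rightarrow> 'w set"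
    and lab :: "'w \<Rightarrow> 'v"
    and con :: "'v \<Rightarrow> ('w, 'w set) mgraph"
    and Y :: "('w, 'w set) mgraph"
  assumes "multigraph X"
    and "connected_mgraph X"
    and "generalized_truncation X M0 F lab con Y"
  shows "(\<forall>C. component C Y \<longrightarrow> eulerian C) \<longleftrightarrow>
         eulerian X \<and> (\<forall>v\<in>verts X. \<forall>w\<in>verts (con v). odd (valency (con v) w))"
proof -
  note T = assms(3)
  have X: "loopless_mgraph X" using assms(1) unfolding multigraph_def by blast
  have Y: "verts Y = \<Union>M0" and con: "\<forall>v\<in>verts X. loopless_mgraph (con v)"
    and verts_con: "\<forall>v\<in>verts X. verts (con v) = cluster M0 lab v"
    using T unfolding generalized_truncation_def simple_graph_def by auto
  have "(\<forall>C. component C Y \<longrightarrow> eulerian C) \<longleftrightarrow> (\<forall>w\<in>\<Union>M0. even (valency Y w))"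
    using components_eulerian_iff[OF generalized_truncation_loopless[OF X T]] Y by simp
  also have "\<dots> \<longleftrightarrow> (\<forall>w\<in>\<Union>M0. odd (valency (con (lab w)) w))"
    using generalized_truncation_valency[OF X T] by simp
  \<comment> \<open>The clusters partition the vertices of \<open>Y\<close>, so running over all
    \<open>w\<close> with their own labels is the same as running over all constituents and their
    vertices.\<close>
  also have "\<dots> \<longleftrightarrow> (\<forall>v\<in>verts X. \<forall>w\<in>verts (con v). odd (valency (con v) w))" (is "_ \<longleftrightarrow> ?odd")
    using generalized_truncation_label[OF X T] verts_con unfolding cluster_def by fastforce
  also have "\<dots> \<longleftrightarrow> eulerian X \<and> ?odd"
  proof -
    have "eulerian X" if ?odd
    \<comment> \<open>Connectedness of \<open>X\<close> enters here, to turn even valencies into an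
      Euler tour.\<close>
    proof (rule even_valency_imp_eulerian[OF X assms(2)])
      fix v assume v: "v \<in> verts X"
      then have "even (card (verts (con v)))"
        using even_card_verts_if_odd_valency con that by blast
      then show "even (valency X v)" using card_cluster[OF X T] verts_con v by simp
    qed
    then show ?thesis by blast
  qed
  finally show ?thesis .
qed

end
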